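(* For all $L\in\mathbf N$, $$\sum_{k=0}^L q^{T(k)}\begin{bmatrix} L\\ k\end{bmatrix}_q(-q)_k=\sum_{j=-\infty}^\infty (-1)^j q^{2j(3j+1)}\begin{bmatrix} 2L+1\\ L-3j\end{bmatrix}_q .$$
   Context: $\mathbf N$ denotes the set of nonnegative integers. For $m\in\mathbf N$, $(a)_m=(a;q)_m=\prod_{j=0}^{m-1}(1-aq^j)$, so $(q)_m=\prod_{j=1}^m(1-q^j)$ and $(-q)_m=\prod_{j=1}^m(1+q^j)$, with $(a)_0=1$. The $q$-binomial coefficient is $\begin{bmatrix} m+n\\ m\end{bmatrix}_q=\frac{(q)_{m+n}}{(q)_m(q)_n}$ if $m,n\in\mathbf N$, and it is $0$ otherwise (so $\begin{bmatrix} A\\ B\end{bmatrix}_q=0$ unless $0\le B\le A$). For $j\in\mathbb Z$, $T(j)=\frac{j(j+1)}{2}$. *)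

theory Defs
  imports Complex_Main "HOL-Library.Groups_Big_Fun"
begin

definition q_poch :: "'a::comm_ring_1 \<Rightarrow> 'a \<Rightarrow> nat \<Rightarrow> 'a" where
  "q_poch a q m = (\<Prod>j<m. 1 - a * q ^ j)"

text \<open>
  The quotient is only meaningful if the factors \<open>1 - q ^ i\<close> in the denominator are nonzero.
\<close>
definition q_binomial :: "'a::field \<Rightarrow> int \<Rightarrow> int \<Rightarrow> 'a" where
  "q_binomial q A B =
    (if 0 \<le> B \<and> B \<le> A
     then q_poch q q (nat A) / (q_poch q q (nat B) * q_poch q q (nat (A - B)))
     else 0)"

definition T :: "int \<Rightarrow> int" where
  "T j = j * (j + 1) div 2"

text \<open>
  \<^const>\<open>Sum_any\<close> is 0 by convention on functions of infinite support; a bilateral sum of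
  \<open>q\<close>-binomial coefficients as below does have finite support.
\<close>
lemma finite_support_q_binomial:
  assumes "c \<noteq> 0"
  shows "finite {j::int. f j * q_binomial q A (B - c * j) \<noteq> 0}"
proof -
  have "{j. f j * q_binomial q A (B - c * j) \<noteq> 0} \<subseteq> (\<lambda>j. B - c * j) -` {0..A}"
    by (auto simp: q_binomial_def split: if_splits)
  moreover have "inj (\<lambda>j. B - c * j)"
    using assms by (auto simp: inj_def)
  ultimately show ?thesis
    by (meson finite_atLeastAtMost_int finite_subset finite_vimageI)
qed

end

theory Submission
  imports Defs
begin

text \<open>
  Both sides satisfy the recurrence
  \<open>S (L + 2) = (1 + q + q ^ (2 * L + 4)) * S (L + 1) - q * (1 - q ^ (2 * L + 2)) * S L\<close>
  and agree at \<open>L = 0, 1\<close>. The recurrence is proved by creative telescoping: applied to the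
  summand it produces a difference of consecutive values of an explicit certificate with finite
  support. Written over a common \<open>q\<close>-factorial denominator, each such identity becomes a Laurent
  polynomial identity in \<open>Q = q ^ L\<close> and \<open>q ^ k\<close> (left) or \<open>q ^ (3 * j)\<close> (right). This needs
  \<open>q \<noteq> 0\<close>; for \<open>q = 0\<close> only the terms with index \<open>0\<close> survive.
\<close>

section \<open>Finite q-products and reciprocal q-factorials\<close>

lemma q_poch_0 [simp]: "q_poch a q 0 = 1"
  by (simp add: q_poch_def)

lemma q_poch_Suc: "q_poch a q (Suc n) = q_poch a q n * (1 - a * q ^ n)"
  by (simp add: q_poch_def)

lemma q_poch_self_nonzero:
  fixes q :: "'a::field"
  assumes "\<And>n::nat. n > 0 \<Longrightarrow> q ^ n \<noteq> 1"
  shows "q_poch q q n \<noteq> 0"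
proof (induction n)
  case (Suc n)
  then show ?case using assms[of "Suc n"] by (simp add: q_poch_Suc)
qed simp

text \<open>
  The value 0 at negative arguments makes \<open>q_rfact_pred\<close> hold for every integer, so the
  vanishing of \<open>q\<close>-binomial coefficients outside their range needs no case distinctions.
\<close>
definition q_rfact :: "'a::field \<Rightarrow> int \<Rightarrow> 'a" where
  "q_rfact q n = (if n < 0 then 0 else inverse (q_poch q q (nat n)))"

lemma q_rfact_pred:
  fixes q :: "'a::field"
  assumes "\<And>n::nat. n > 0 \<Longrightarrow> q ^ n \<noteq> 1"
  shows "q_rfact q (n - 1) = (1 - q powi n) * q_rfact q n"
proof (cases "n > 0")
  case True
  then obtain m where n: "n = int (Suc m)"
    using zero_less_imp_eq_int by (metis gr0_implies_Suc of_nat_0_less_iff)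
  have "nat (1 + int m) = Suc m" by simp
  then show ?thesis
    using q_poch_self_nonzero[OF assms, of m] assms[of "Suc m"]
    by (simp add: n q_rfact_def q_poch_Suc del: of_nat_Suc power_Suc flip: power_Suc)
      (simp add: field_simps)
\<comment> \<open>For \<open>n < 0\<close> both sides are 0 by convention. At \<open>n = 0\<close>
  the right side vanishes through the factor \<open>1 - q powi 0\<close>.\<close>
qed (auto simp: q_rfact_def)

text \<open>If \<open>B < 0\<close> or \<open>B > A\<close>, one of the two \<open>q_rfact\<close>
  arguments is negative, which reproduces the value 0 of the coefficient.\<close>

lemma q_binomial_eq_rfact:
  "q_binomial q (int A) B = q_poch q q A * q_rfact q B * q_rfact q (int A - B)"
  by (auto simp: q_binomial_def q_rfact_def field_simps)

lemma T_Suc: "T (int (Suc k)) = T (int k) + int k + 1"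
proof -
  \<comment> \<open>The increment appears as a multiple of 2, so it can be pulled out of
    \<open>div 2\<close>.\<close>
  have "(int (Suc k)) * (int (Suc k) + 1) = int k * (int k + 1) + (int k + 1) * 2"
    by (simp add: algebra_simps)
  then show ?thesis unfolding T_def by (simp only: div_mult_self2) simp
qed

lemma q_powi_T_Suc:
  assumes "q \<noteq> (0::'a::field)"
  shows "q powi T (int (Suc k)) = q powi T (int k) * q ^ k * q"
  using assms by (simp only: T_Suc power_int_add power_int_of_nat power_int_1_right simp_thms)

section \<open>Telescoping for the left summand\<close>

definition left_term :: "'a::field \<Rightarrow> nat \<Rightarrow> nat \<Rightarrow> 'a" where
  "left_term q L k = q powi T (int k) * q_binomial q (int L) (int k) * q_poch (- q) q k"

text \<open>The telescoping certificate. Its two \<open>q_rfact\<close> factors make it vanish at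
  \<open>k = 0\<close> and for \<open>k > L + 2\<close>.\<close>

definition left_cert :: "'a::field \<Rightarrow> nat \<Rightarrow> nat \<Rightarrow> 'a" where
  "left_cert q L k = q ^ (2 * L + 4) / (q ^ k)\<^sup>2 * q powi T (int k) * q_poch (- q) q k
     * q_poch q q (Suc L) * q_rfact q (int k - 1) * q_rfact q (int L + 2 - int k)"

lemma left_term_recurrence:
  fixes q :: "'a::field"
  assumes q: "\<And>n::nat. n > 0 \<Longrightarrow> q ^ n \<noteq> 1" and "q \<noteq> 0"
  shows "left_term q (L + 2) k - (1 + q + q ^ (2 * L + 4)) * left_term q (L + 1) k
      + q * (1 - q ^ (2 * L + 2)) * left_term q L k
    = left_cert q L k - left_cert q L (Suc k)"
proof -
  define y Q where "y = q ^ k" and "Q = q ^ L"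
  \<comment> \<open>The common factor of all five terms. \<open>q_rfact_pred\<close> lowers
    arguments, so \<open>c\<close> carries the largest \<open>q_rfact\<close> arguments that occur;
    \<open>q_poch q q\<close> grows by factors, so \<open>c\<close> carries the smallest
    index.\<close>
  define c where "c = q powi T (int k) * q_poch (- q) q k * q_poch q q L
    * q_rfact q (int k) * q_rfact q (int L + 2 - int k)"
  have y0: "y \<noteq> 0" using \<open>q \<noteq> 0\<close> by (simp add: y_def)
  have pL: "q_poch q q (L + 1) = q_poch q q L * (1 - q * Q)"
    "q_poch q q (L + 2) = q_poch q q L * (1 - q * Q) * (1 - q\<^sup>2 * Q)"
    by (simp_all add: q_poch_Suc Q_def power2_eq_square mult.assoc)
  have pk: "q_poch (- q) q (Suc k) = q_poch (- q) q k * (1 + q * y)"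
    by (simp add: q_poch_Suc y_def)
  have w: "q powi (int L + 2 - int k) = q\<^sup>2 * Q / y" "q powi (int L + 1 - int k) = q * Q / y"
    using \<open>q \<noteq> 0\<close> by (simp_all add: power_int_add power_int_diff Q_def y_def)
  have r1: "q_rfact q (int L + 1 - int k) = (1 - q\<^sup>2 * Q / y) * q_rfact q (int L + 2 - int k)"
    using q_rfact_pred[OF q, of "int L + 2 - int k"] by (simp only: w) (simp add: algebra_simps)
  have r0: "q_rfact q (int L - int k) = (1 - q * Q / y) * q_rfact q (int L + 1 - int k)"
    using q_rfact_pred[OF q, of "int L + 1 - int k"] by (simp only: w) (simp add: algebra_simps)
  have rk: "q_rfact q (int k - 1) = (1 - y) * q_rfact q (int k)"
    using q_rfact_pred[OF q, of "int k"] by (simp add: y_def)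
  have Q2: "q ^ (2 * L + 4) = q ^ 4 * Q\<^sup>2" "q ^ (2 * L + 2) = q\<^sup>2 * Q\<^sup>2"
    unfolding power_add power_even_eq Q_def by (rule mult.commute)+
  have t2: "left_term q (L + 2) k = c * ((1 - q * Q) * (1 - q\<^sup>2 * Q))"
    unfolding left_term_def q_binomial_eq_rfact pL c_def
    by (simp add: algebra_simps)
  have t1: "left_term q (L + 1) k = c * ((1 - q * Q) * (1 - q\<^sup>2 * Q / y))"
  proof -
    have "int (L + 1) - int k = int L + 1 - int k" by simp
    then show ?thesis
      unfolding left_term_def q_binomial_eq_rfact pL c_def by (simp only: r1 mult_ac)
  qed
  have t0: "left_term q L k = c * ((1 - q * Q / y) * (1 - q\<^sup>2 * Q / y))"
    unfolding left_term_def q_binomial_eq_rfact c_def by (simp only: r0 r1 mult_ac)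
  have g0: "left_cert q L k = c * (q ^ 4 * Q\<^sup>2 / y\<^sup>2 * (1 - q * Q) * (1 - y))"
    unfolding left_cert_def c_def rk Q2 y_def[symmetric] Suc_eq_plus1 pL by (simp only: mult_ac)
  have g1: "left_cert q L (Suc k)
    = c * (q ^ 4 * Q\<^sup>2 / (q * y)\<^sup>2 * (1 - q * Q) * (q * y * (1 + q * y)) * (1 - q\<^sup>2 * Q / y))"
  proof -
    have "int (Suc k) - 1 = int k" "int L + 2 - int (Suc k) = int L + 1 - int k"
      "q ^ Suc k = q * y" "q_poch q q (Suc L) = q_poch q q L * (1 - q * Q)"
      using pL(1) by (simp_all add: y_def)
    then show ?thesis
      unfolding left_cert_def c_def Q2 q_powi_T_Suc[OF \<open>q \<noteq> 0\<close>] pk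
      by (simp only: r1 y_def[symmetric] mult_ac)
  qed
  \<comment> \<open>The recurrence stripped of \<open>c\<close>. After clearing denominators it is a
    polynomial identity in independent \<open>q\<close>, \<open>Q\<close>, \<open>y\<close>. It is
    multiplied by \<open>c\<close> afterwards, since \<open>c\<close> may be 0.\<close>
  have "(1 - q * Q) * (1 - q\<^sup>2 * Q)
      - (1 + q + q ^ 4 * Q\<^sup>2) * ((1 - q * Q) * (1 - q\<^sup>2 * Q / y))
      + q * (1 - q\<^sup>2 * Q\<^sup>2) * ((1 - q * Q / y) * (1 - q\<^sup>2 * Q / y))
    = q ^ 4 * Q\<^sup>2 / y\<^sup>2 * (1 - q * Q) * (1 - y)
      - q ^ 4 * Q\<^sup>2 / (q * y)\<^sup>2 * (1 - q * Q) * (q * y * (1 + q * y)) * (1 - q\<^sup>2 * Q / y)"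
    using y0 \<open>q \<noteq> 0\<close>
    by (simp add: divide_simps power2_eq_square) algebra
  then show ?thesis
    unfolding t2 t1 t0 g0 g1 Q2
    by (simp only: right_diff_distrib[symmetric] distrib_left[symmetric] mult.left_commute[of _ c])
qed

section \<open>Telescoping for the right summand\<close>

definition right_term :: "'a::field \<Rightarrow> nat \<Rightarrow> int \<Rightarrow> 'a" where
  "right_term q L j = (- 1) powi j * q powi (2 * j * (3 * j + 1))
     * q_binomial q (2 * int L + 1) (int L - 3 * j)"

text \<open>The analogous certificate; it is nonzero only if \<open>- int L \<le> 3 * j\<close> and
  \<open>3 * j \<le> int L + 2\<close>.\<close>

definition right_cert :: "'a::field \<Rightarrow> nat \<Rightarrow> int \<Rightarrow> 'a" where
  "right_cert q L j = (- 1) powi j * q powi (2 * j * (3 * j + 1)) / (q powi (3 * j))\<^sup>2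
     * q ^ (2 * L + 4) * q_poch q q (2 * L + 2)
     * q_rfact q (int L + 2 - 3 * j) * q_rfact q (int L + 3 * j)"

lemma right_term_eq_rfact:
  "right_term q L j = (- 1) powi j * q powi (2 * j * (3 * j + 1)) * q_poch q q (2 * L + 1)
     * q_rfact q (int L - 3 * j) * q_rfact q (int L + 1 + 3 * j)"
proof -
  have "2 * int L + 1 = int (2 * L + 1)" "int (2 * L + 1) - (int L - 3 * j) = int L + 1 + 3 * j"
    by simp_all
  then show ?thesis by (simp only: right_term_def q_binomial_eq_rfact mult_ac)
qed

lemma right_term_recurrence:
  fixes q :: "'a::field"
  assumes q: "\<And>n::nat. n > 0 \<Longrightarrow> q ^ n \<noteq> 1" and "q \<noteq> 0"
  shows "right_term q (L + 2) j - (1 + q + q ^ (2 * L + 4)) * right_term q (L + 1) j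
      + q * (1 - q ^ (2 * L + 2)) * right_term q L j
    = right_cert q L j - right_cert q L (j + 1)"
proof -
  define x Q where "x = q powi (3 * j)" and "Q = q ^ L"
  define c where "c = (- 1) powi j * q powi (2 * j * (3 * j + 1)) * q_poch q q (2 * L + 1)
    * q_rfact q (int L + 2 - 3 * j) * q_rfact q (int L + 3 + 3 * j)"
  have x0: "x \<noteq> 0" using \<open>q \<noteq> 0\<close> by (simp add: x_def)
  have QQ: "q ^ (2 * L) = Q * Q" "q ^ (Suc (Suc 0) * L) = Q * Q"
    by (simp_all add: Q_def mult_2 power_add)
  have p2: "q_poch q q (2 * L + 2) = q_poch q q (2 * L + 1) * (1 - q\<^sup>2 * Q\<^sup>2)"
   and p3: "q_poch q q (2 * L + 3) = q_poch q q (2 * L + 1) * (1 - q\<^sup>2 * Q\<^sup>2) * (1 - q ^ 3 * Q\<^sup>2)"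
   and p5: "q_poch q q (2 * L + 5) = q_poch q q (2 * L + 1) * (1 - q\<^sup>2 * Q\<^sup>2) * (1 - q ^ 3 * Q\<^sup>2)
      * (1 - q ^ 4 * Q\<^sup>2) * (1 - q ^ 5 * Q\<^sup>2)"
    by (simp_all add: q_poch_Suc eval_nat_numeral QQ mult.assoc del: mult_Suc mult_Suc_right)
  have Q2: "q ^ (2 * L + 4) = q ^ 4 * Q\<^sup>2" "q ^ (2 * L + 2) = q\<^sup>2 * Q\<^sup>2"
    unfolding power_add power_even_eq Q_def by (rule mult.commute)+
  have wm: "q powi (int L + int i - 3 * j) = q ^ i * Q / x" for i
    using \<open>q \<noteq> 0\<close> by (simp add: power_int_add power_int_diff Q_def x_def)
  have wp: "q powi (int L + int i + 3 * j) = q ^ i * Q * x" for i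
    using \<open>q \<noteq> 0\<close> by (simp add: power_int_add Q_def x_def)
  \<comment> \<open>Replacing \<open>j\<close> by \<open>j + 1\<close> moves the arguments by 3,
    hence three descents on each side: \<open>m'\<close> serves the certificate at
    \<open>j + 1\<close>, \<open>n0\<close> the one at \<open>j\<close>.\<close>
  have m1: "q_rfact q (int L + 1 - 3 * j) = (1 - q\<^sup>2 * Q / x) * q_rfact q (int L + 2 - 3 * j)"
    using q_rfact_pred[OF q, of "int L + int 2 - 3 * j"] by (simp only: wm) (simp add: algebra_simps)
  have m0: "q_rfact q (int L - 3 * j) = (1 - q * Q / x) * q_rfact q (int L + 1 - 3 * j)"
    using q_rfact_pred[OF q, of "int L + int 1 - 3 * j"] by (simp only: wm) (simp add: algebra_simps)
  have m': "q_rfact q (int L - 1 - 3 * j) = (1 - Q / x) * q_rfact q (int L - 3 * j)"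
    using q_rfact_pred[OF q, of "int L + int 0 - 3 * j"] by (simp only: wm) (simp add: algebra_simps)
  have n2: "q_rfact q (int L + 2 + 3 * j) = (1 - q ^ 3 * Q * x) * q_rfact q (int L + 3 + 3 * j)"
    using q_rfact_pred[OF q, of "int L + int 3 + 3 * j"] by (simp only: wp) (simp add: algebra_simps)
  have n1: "q_rfact q (int L + 1 + 3 * j) = (1 - q\<^sup>2 * Q * x) * q_rfact q (int L + 2 + 3 * j)"
    using q_rfact_pred[OF q, of "int L + int 2 + 3 * j"] by (simp only: wp) (simp add: algebra_simps)
  have n0: "q_rfact q (int L + 3 * j) = (1 - q * Q * x) * q_rfact q (int L + 1 + 3 * j)"
    using q_rfact_pred[OF q, of "int L + int 1 + 3 * j"] by (simp only: wp) (simp add: algebra_simps)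
  have t2: "right_term q (L + 2) j = c * ((1 - q\<^sup>2 * Q\<^sup>2) * (1 - q ^ 3 * Q\<^sup>2)
      * (1 - q ^ 4 * Q\<^sup>2) * (1 - q ^ 5 * Q\<^sup>2))"
  proof -
    have e: "int (L + 2) - 3 * j = int L + 2 - 3 * j" "int (L + 2) + 1 + 3 * j = int L + 3 + 3 * j"
      "2 * (L + 2) + 1 = 2 * L + 5" by simp_all
    show ?thesis unfolding right_term_eq_rfact c_def e p5 by (simp only: mult_ac)
  qed
  have t1: "right_term q (L + 1) j = c * ((1 - q\<^sup>2 * Q\<^sup>2) * (1 - q ^ 3 * Q\<^sup>2)
      * (1 - q\<^sup>2 * Q / x) * (1 - q ^ 3 * Q * x))"
  proof -
    have e: "int (L + 1) - 3 * j = int L + 1 - 3 * j" "int (L + 1) + 1 + 3 * j = int L + 2 + 3 * j"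
      "2 * (L + 1) + 1 = 2 * L + 3" by simp_all
    show ?thesis unfolding right_term_eq_rfact c_def e p3 m1 n2 by (simp only: mult_ac)
  qed
  have t0: "right_term q L j = c * ((1 - q * Q / x) * (1 - q\<^sup>2 * Q / x)
      * (1 - q\<^sup>2 * Q * x) * (1 - q ^ 3 * Q * x))"
    unfolding right_term_eq_rfact c_def m0 m1 n1 n2 by (simp only: mult_ac)
  have g0: "right_cert q L j = c * (q ^ 4 * Q\<^sup>2 * (1 - q\<^sup>2 * Q\<^sup>2) / x\<^sup>2
      * (1 - q * Q * x) * (1 - q\<^sup>2 * Q * x) * (1 - q ^ 3 * Q * x))"
    unfolding right_cert_def c_def Q2 p2 x_def[symmetric] n0 n1 n2
    by (simp only: mult_ac times_divide_eq_left times_divide_eq_right)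
  have g1: "right_cert q L (j + 1) = - c * (q ^ 6 * Q\<^sup>2 * x\<^sup>2 * (1 - q\<^sup>2 * Q\<^sup>2)
      * (1 - Q / x) * (1 - q * Q / x) * (1 - q\<^sup>2 * Q / x))"
  proof -
    have e: "int L + 2 - 3 * (j + 1) = int L - 1 - 3 * j" "int L + 3 * (j + 1) = int L + 3 + 3 * j"
      by simp_all
    \<comment> \<open>The exponent grows by \<open>12 * j + 8\<close>, a multiple of
      \<open>3 * j\<close> plus a constant, so the shift stays polynomial in
      \<open>x\<close>.\<close>
    have "2 * (j + 1) * (3 * (j + 1) + 1) = 2 * j * (3 * j + 1) + 3 * j * 4 + 8"
      by (simp add: algebra_simps)
    then have w: "q powi (2 * (j + 1) * (3 * (j + 1) + 1))
      = q powi (2 * j * (3 * j + 1)) * x ^ 4 * q ^ 8"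
      using \<open>q \<noteq> 0\<close> by (simp only: power_int_add x_def simp_thms power_int_mult) simp
    have v: "q powi (3 * (j + 1)) = q ^ 3 * x"
      using \<open>q \<noteq> 0\<close> by (simp add: distrib_left power_int_add x_def)
    have s: "(- 1 :: 'a) powi (j + 1) = - ((- 1) powi j)"
      by (simp add: power_int_add)
    have "x ^ 4 * q ^ 8 / (q ^ 3 * x)\<^sup>2 * (q ^ 4 * Q\<^sup>2) = q ^ 6 * Q\<^sup>2 * x\<^sup>2"
      using x0 \<open>q \<noteq> 0\<close> by (simp add: field_simps)
    moreover have "right_cert q L (j + 1) = - c * (x ^ 4 * q ^ 8 / (q ^ 3 * x)\<^sup>2 * (q ^ 4 * Q\<^sup>2)
      * (1 - q\<^sup>2 * Q\<^sup>2) * (1 - Q / x) * (1 - q * Q / x) * (1 - q\<^sup>2 * Q / x))"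
      unfolding right_cert_def c_def Q2 p2 w v s e m' m0 m1
      by (simp only: mult_ac times_divide_eq_left times_divide_eq_right mult_minus_left mult_minus_right)
    ultimately show ?thesis by simp
  qed
  \<comment> \<open>The alternating sign makes \<open>g1\<close> negative, so the difference of
    certificates becomes a sum here.\<close>
  have "(1 - q\<^sup>2 * Q\<^sup>2) * (1 - q ^ 3 * Q\<^sup>2) * (1 - q ^ 4 * Q\<^sup>2) * (1 - q ^ 5 * Q\<^sup>2)
      - (1 + q + q ^ 4 * Q\<^sup>2) * ((1 - q\<^sup>2 * Q\<^sup>2) * (1 - q ^ 3 * Q\<^sup>2)
        * (1 - q\<^sup>2 * Q / x) * (1 - q ^ 3 * Q * x))
      + q * (1 - q\<^sup>2 * Q\<^sup>2) * ((1 - q * Q / x) * (1 - q\<^sup>2 * Q / x)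
        * (1 - q\<^sup>2 * Q * x) * (1 - q ^ 3 * Q * x))
    = q ^ 4 * Q\<^sup>2 * (1 - q\<^sup>2 * Q\<^sup>2) / x\<^sup>2
        * (1 - q * Q * x) * (1 - q\<^sup>2 * Q * x) * (1 - q ^ 3 * Q * x)
      + q ^ 6 * Q\<^sup>2 * x\<^sup>2 * (1 - q\<^sup>2 * Q\<^sup>2)
        * (1 - Q / x) * (1 - q * Q / x) * (1 - q\<^sup>2 * Q / x)"
    using x0
    by (simp add: divide_simps power2_eq_square) algebra
  then show ?thesis
    unfolding t2 t1 t0 g0 g1 Q2 minus_mult_left[symmetric] diff_minus_eq_add
    by (simp only: right_diff_distrib[symmetric] distrib_left[symmetric] mult.left_commute[of _ c])
qed

section \<open>Summing the recurrences over a common range\<close>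

lemma left_sum_superset:
  assumes "L \<le> M"
  shows "(\<Sum>k=0..L. left_term q L k) = (\<Sum>k<Suc M. left_term q L k)"
  by (rule sum.mono_neutral_left) (use assms in \<open>auto simp: left_term_def q_binomial_def\<close>)

lemma left_sum_recurrence:
  fixes q :: "'a::field"
  assumes q: "\<And>n::nat. n > 0 \<Longrightarrow> q ^ n \<noteq> 1" and "q \<noteq> 0"
  shows "(\<Sum>k=0..L + 2. left_term q (L + 2) k)
    = (1 + q + q ^ (2 * L + 4)) * (\<Sum>k=0..L + 1. left_term q (L + 1) k)
      - q * (1 - q ^ (2 * L + 2)) * (\<Sum>k=0..L. left_term q L k)"
proof -
  have "(\<Sum>k<Suc (L + 2). left_term q (L + 2) k - (1 + q + q ^ (2 * L + 4)) * left_term q (L + 1) k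
      + q * (1 - q ^ (2 * L + 2)) * left_term q L k)
    = (\<Sum>k<Suc (L + 2). left_cert q L k - left_cert q L (Suc k))"
    by (intro sum.cong refl left_term_recurrence assms)
  also have "\<dots> = left_cert q L 0 - left_cert q L (Suc (L + 2))"
    by (rule sum_lessThan_telescope')
  \<comment> \<open>At both ends, \<open>k = 0\<close> and \<open>k = L + 3\<close>, a
    \<open>q_rfact\<close> factor has argument -1.\<close>
  also have "\<dots> = 0" by (simp add: left_cert_def q_rfact_def)
  finally have "(\<Sum>k<Suc (L + 2). left_term q (L + 2) k)
      - (1 + q + q ^ (2 * L + 4)) * (\<Sum>k<Suc (L + 2). left_term q (L + 1) k)
      + q * (1 - q ^ (2 * L + 2)) * (\<Sum>k<Suc (L + 2). left_term q L k) = 0"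
    by (simp only: sum.distrib sum_subtractf sum_distrib_left)
  moreover have "(\<Sum>k=0..L. left_term q L k) = (\<Sum>k<Suc (L + 2). left_term q L k)"
    "(\<Sum>k=0..L + 1. left_term q (L + 1) k) = (\<Sum>k<Suc (L + 2). left_term q (L + 1) k)"
    "(\<Sum>k=0..L + 2. left_term q (L + 2) k) = (\<Sum>k<Suc (L + 2). left_term q (L + 2) k)"
    by (rule left_sum_superset; simp)+
  ultimately show ?thesis by (simp only: eq_diff_eq diff_add_eq diff_eq_eq add_0)
qed

text \<open>A deliberately crude bound: the coefficient forces
  \<open>- int L - 1 \<le> 3 * j\<close> and \<open>3 * j \<le> int L\<close>.\<close>

lemma right_term_support: "right_term q L j \<noteq> 0 \<Longrightarrow> \<bar>j\<bar> \<le> int L"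
  by (auto simp: right_term_def q_binomial_def split: if_splits)

lemma Sum_any_right_term:
  assumes "L \<le> M"
  shows "Sum_any (right_term q L) = (\<Sum>j=- int M..<int M + 1. right_term q L j)"
  by (rule Sum_any.expand_superset) (use assms right_term_support[of q L] in force)+

text \<open>Provides the initial values: for \<open>L \<le> 1\<close>, \<open>3 * j\<close> lies
  between -2 and 1, which leaves only \<open>j = 0\<close>.\<close>

lemma Sum_any_right_term_le_1:
  assumes "L \<le> 1"
  shows "Sum_any (right_term q L) = right_term q L 0"
proof -
  have "{j. right_term q L j \<noteq> 0} \<subseteq> {0}"
    using assms by (auto simp: right_term_def q_binomial_def split: if_splits)
  from Sum_any.expand_superset[OF _ this] show ?thesis by simp
qed

lemma Sum_any_right_term_recurrence:
  fixes q :: "'a::field"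
  assumes q: "\<And>n::nat. n > 0 \<Longrightarrow> q ^ n \<noteq> 1" and "q \<noteq> 0"
  shows "Sum_any (right_term q (L + 2))
    = (1 + q + q ^ (2 * L + 4)) * Sum_any (right_term q (L + 1))
      - q * (1 - q ^ (2 * L + 2)) * Sum_any (right_term q L)"
proof -
  define M where "M = L + 2"
  have tele: "(\<Sum>j=a..<a + int n. f j - f (j + 1)) = f a - f (a + int n)"
    for f :: "int \<Rightarrow> 'a" and a n
  proof (induction n)
    case (Suc n)
    have "{a..<a + int (Suc n)} = insert (a + int n) {a..<a + int n}" by auto
    with Suc show ?case by (simp add: add_ac)
  qed simp
  have "(\<Sum>j=- int M..<int M + 1. right_term q (L + 2) j
      - (1 + q + q ^ (2 * L + 4)) * right_term q (L + 1) j
      + q * (1 - q ^ (2 * L + 2)) * right_term q L j)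
    = (\<Sum>j=- int M..<int M + 1. right_cert q L j - right_cert q L (j + 1))"
    by (intro sum.cong refl right_term_recurrence assms)
  also have "\<dots> = right_cert q L (- int M) - right_cert q L (int M + 1)"
    \<comment> \<open>There are \<open>2 * M + 1\<close> integers from \<open>- int M\<close> to
      \<open>int M\<close>.\<close>
    using tele[of "right_cert q L" "- int M" "2 * M + 1"] by (simp add: algebra_simps)
  \<comment> \<open>The argument \<open>int L + 3 * j\<close> is negative at the lower end,
    \<open>int L + 2 - 3 * j\<close> at the upper end.\<close>
  also have "\<dots> = 0" by (simp add: right_cert_def q_rfact_def M_def)
  finally have "(\<Sum>j=- int M..<int M + 1. right_term q (L + 2) j)
      - (1 + q + q ^ (2 * L + 4)) * (\<Sum>j=- int M..<int M + 1. right_term q (L + 1) j)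
      + q * (1 - q ^ (2 * L + 2)) * (\<Sum>j=- int M..<int M + 1. right_term q L j) = 0"
    by (simp only: sum.distrib sum_subtractf sum_distrib_left)
  moreover have "Sum_any (right_term q L) = (\<Sum>j=- int M..<int M + 1. right_term q L j)"
    "Sum_any (right_term q (L + 1)) = (\<Sum>j=- int M..<int M + 1. right_term q (L + 1) j)"
    "Sum_any (right_term q (L + 2)) = (\<Sum>j=- int M..<int M + 1. right_term q (L + 2) j)"
    by (rule Sum_any_right_term; simp add: M_def)+
  ultimately show ?thesis by (simp only: eq_diff_eq diff_add_eq diff_eq_eq add_0)
qed

section \<open>Initial values, induction and the case \<open>q = 0\<close>\<close>

lemma sum_left_term_eq_Sum_any_right_term:
  fixes q :: "'a::field"
  assumes q: "\<And>n::nat. n > 0 \<Longrightarrow> q ^ n \<noteq> 1" and "q \<noteq> 0"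
  shows "(\<Sum>k=0..L. left_term q L k) = Sum_any (right_term q L)"
proof (induction L rule: induct_nat_012)
  case 0
  have "right_term q 0 0 = 1"
    using assms(1)[of 1] by (simp add: right_term_def q_binomial_def q_poch_Suc)
  then show ?case
    by (simp add: Sum_any_right_term_le_1 left_term_def q_binomial_def T_def)
next
  case 1
  \<comment> \<open>At \<open>L = 1\<close> the right side is the q-binomial of 3 over 1, and the
    left side is \<open>1 + q * (1 + q)\<close>.\<close>
  have "q_poch q q 3 = (1 + q + q\<^sup>2) * (q_poch q q 1 * q_poch q q 2)"
    by (simp add: q_poch_Suc eval_nat_numeral algebra_simps)
  then have "right_term q 1 0 = 1 + q + q\<^sup>2"
    using q_poch_self_nonzero[OF assms(1)]
    by (simp add: right_term_def q_binomial_def)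
  also have "\<dots> = (\<Sum>k=0..1. left_term q 1 k)"
    using assms(1)[of 1]
    by (simp add: left_term_def q_binomial_def T_def q_poch_Suc power2_eq_square field_simps)
  finally show ?case by (simp add: Sum_any_right_term_le_1)
next
  case (ge2 n)
  then show ?case
    using left_sum_recurrence[OF assms, of n] Sum_any_right_term_recurrence[OF assms, of n]
    by simp
qed

theorem mainTheorem3:
  fixes q :: "'a::field" and L :: nat
  assumes "\<And>n::nat. n > 0 \<Longrightarrow> q ^ n \<noteq> 1"
  shows "(\<Sum>k=0..L. q powi T (int k) * q_binomial q (int L) (int k) * q_poch (- q) q k) =
    Sum_any (\<lambda>j::int. (- 1) powi j * q powi (2 * j * (3 * j + 1))
      * q_binomial q (2 * int L + 1) (int L - 3 * j))"
proof (cases "q = 0")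
  case False
  then show ?thesis
    using sum_left_term_eq_Sum_any_right_term[OF assms, of L]
    by (simp only: left_term_def right_term_def[abs_def] simp_thms)
next
  case True
  \<comment> \<open>For \<open>q = 0\<close> a power \<open>q powi e\<close> is 1 if
    \<open>e = 0\<close> and 0 otherwise, also for negative \<open>e\<close>; it remains to find
    where the exponents vanish.\<close>
  have T_ge: "int k \<le> T (int k)" for k
  proof (induction k)
    case (Suc k)
    then show ?case by (simp only: T_Suc)
  qed (simp add: T_def)
  have "T (int k) \<noteq> 0" if "k > 0" for k
    using that T_ge[of k] by auto
  then have "(\<Sum>k=0..L. left_term q L k) = (\<Sum>k\<in>{0}. left_term q L k)"
    by (intro sum.mono_neutral_right) (auto simp: left_term_def True power_int_0_left_if)
  also have "\<dots> = right_term q L 0"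
    by (simp add: left_term_def right_term_def True q_binomial_def T_def q_poch_def)
  also have "\<dots> = Sum_any (right_term q L)"
  proof -
    have "j = 0" if "right_term q L j \<noteq> 0" for j
    proof -
      have "j * (3 * j + 1) = 0"
        using that by (auto simp: right_term_def True power_int_0_left_if split: if_splits)
      \<comment> \<open>The other root, -1/3, is not an integer.\<close>
      then show ?thesis by auto
    qed
    then have "{j. right_term q L j \<noteq> 0} \<subseteq> {0}" by auto
    from Sum_any.expand_superset[OF _ this] show ?thesis by simp
  qed
  finally show ?thesis by (simp only: left_term_def right_term_def[abs_def])
qed

end
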